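(* Let $K$ be an algebraically closed field of characteristic $0$, let $n,d$ be positive integers, and let $V$ be a $K$-vector space of dimension $n+1$. Let $P\in\sigma_2(\nu_d(\mathbb{P}^n))\subset\mathbb{P}(S^dV)\subset\mathbb{P}(V^{\otimes d})$. Then the symmetric rank of $P$ equals its tensor rank: $$r_{\nu_d(\mathbb{P}^n)}(P)=r_{X_{n,\dots,n}}(P),$$ where $X_{n,\dots,n}\subset\mathbb{P}(V^{\otimes d})$ is the Segre variety of $d$ copies of $\mathbb{P}^n=\mathbb{P}(V)$.
   Context: Work over an algebraically closed field $K$ of characteristic $0$. Let $\mathbb{P}^n=\mathbb{P}(V)$ with $\dim V=n+1$, and let $S^dV\subset V^{\otimes d}$ be the subspace of symmetric tensors. The Segre variety $X_{n,\dots,n}\subset\mathbb{P}(V^{\otimes d})$ ($d$ indices) is the set of classes $[v_1\otimes\cdots\otimes v_d]$ with $0\ne v_i\in V$. The Veronese variety is $\nu_d(\mathbb{P}^n)=X_{n,\dots,n}\cap\mathbb{P}(S^dV)=\{[v^{\otimes d}]: 0\neq v\in V\}$. The tensor rank $r_{X_{n,\dots,n}}(P)$ of $P\in\mathbb{P}(V^{\otimes d})$ is the minimal cardinality of a finite set $S\subset X_{n,\dots,n}$ whose linear span contains $P$. The symmetric rank $r_{\nu_d(\mathbb{P}^n)}(P)$ of $P\in\mathbb{P}(S^dV)$ is the minimal number of points of $\nu_d(\mathbb{P}^n)$ whose linear span contains $P$. $\sigma_2(\nu_d(\mathbb{P}^n))$ is the Zariski closure in $\mathbb{P}(S^dV)$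 of the union of all lines spanned by two distinct points of $\nu_d(\mathbb{P}^n)$. *)

theory Defs
  imports "HOL-Analysis.Analysis" "HOL-Computational_Algebra.Computational_Algebra"
begin

text \<open>
  A point of projective space is a one-dimensional subspace, kept as the set of its vectors;
  a set of points is therefore a set of such lines.
\<close>

definition proj_class :: "'k::field ^ 'm \<Rightarrow> ('k ^ 'm) set"
  where "proj_class x = vec.span {x}"

definition projectivization :: "('k::field ^ 'm) set \<Rightarrow> ('k ^ 'm) set set"
  where "projectivization W = {proj_class x | x. x \<in> W \<and> x \<noteq> 0}"

definition proj_span :: "('k::field ^ 'm) set set \<Rightarrow> ('k ^ 'm) set set"
  where "proj_span S = projectivization (vec.span (\<Union>S))"

text \<open>
  The value is \<open>\<infinity>\<close> if the point is not in the span of any finite subset of \<open>X\<close>;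
  otherwise the infimum is attained, because \<^typ>\<open>enat\<close> is well-ordered.
\<close>

definition rank_wrt :: "('k::field ^ 'm) set set \<Rightarrow> ('k ^ 'm) set \<Rightarrow> enat"
  where "rank_wrt X P = (INF S \<in> {S. S \<subseteq> X \<and> finite S \<and> P \<in> proj_span S}. enat (card S))"

text \<open>
  Polynomials are represented by the functions they induce; over an infinite field nothing is lost.
  The index set of the sum, the exponent vectors of total degree \<open>e\<close>, is finite
  because \<open>'m\<close> is.
\<close>

definition homogeneous_poly_fun :: "nat \<Rightarrow> ('k::field ^ 'm \<Rightarrow> 'k) \<Rightarrow> bool"
  where "homogeneous_poly_fun e F \<longleftrightarrow>
    (\<exists>c :: ('m \<Rightarrow> nat) \<Rightarrow> 'k.
       F = (\<lambda>x. \<Sum>\<alpha> | (\<Sum>i\<in>UNIV. \<alpha> i) = e. c \<alpha> * (\<Prod>i\<in>UNIV. (x $ i) ^ \<alpha> i)))"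

lemma finite_exponents: "finite {\<alpha> :: 'm::finite \<Rightarrow> nat. (\<Sum>i\<in>UNIV. \<alpha> i) = e}"
proof (rule finite_subset)
  show "{\<alpha> :: 'm \<Rightarrow> nat. (\<Sum>i\<in>UNIV. \<alpha> i) = e} \<subseteq> (UNIV \<rightarrow>\<^sub>E {..e})"
    by (auto intro: member_le_sum)
  show "finite ((UNIV :: 'm set) \<rightarrow>\<^sub>E {..e})"
    by (intro finite_PiE) auto
qed

definition proj_zero_locus ::
    "('k::field ^ 'm) set \<Rightarrow> ('k ^ 'm \<Rightarrow> 'k) set \<Rightarrow> ('k ^ 'm) set set"
  where "proj_zero_locus W \<F> = {P \<in> projectivization W. \<forall>F\<in>\<F>. \<forall>x\<in>P. F x = 0}"

text \<open>
  Homogeneous polynomials on a subspace \<open>W\<close> are the restrictions of homogeneous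
  polynomials on the ambient space, so ambient ones suffice to define the Zariski topology
  of the projectivization of \<open>W\<close>.
\<close>

definition zariski_closed_in :: "('k::field ^ 'm) set \<Rightarrow> ('k ^ 'm) set set \<Rightarrow> bool"
  where "zariski_closed_in W Z \<longleftrightarrow>
    (\<exists>\<F>. (\<forall>F\<in>\<F>. \<exists>e. homogeneous_poly_fun e F) \<and> Z = proj_zero_locus W \<F>)"

definition zariski_closure_in ::
    "('k::field ^ 'm) set \<Rightarrow> ('k ^ 'm) set set \<Rightarrow> ('k ^ 'm) set set"
  where "zariski_closure_in W A = \<Inter>{Z. zariski_closed_in W Z \<and> A \<subseteq> Z}"

text \<open>
  \<open>V\<close> is \<open>'k ^ 'n\<close>, and the type \<open>'d\<close> indexes the tensor factors.
  A tensor is given by its coordinates in the basis of tensor products of standard basis vectors,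
  one coordinate for each multi-index \<open>'d \<Rightarrow> 'n\<close>.
\<close>

type_synonym ('k, 'n, 'd) tensor = "('k, 'd \<Rightarrow> 'n) vec"

definition pure_tensor :: "('d::finite \<Rightarrow> 'k::field ^ 'n::finite) \<Rightarrow> ('k, 'n, 'd) tensor"
  where "pure_tensor v = (\<chi> I. \<Prod>j\<in>UNIV. v j $ I j)"

definition symmetric_tensors :: "('k::field, 'n::finite, 'd::finite) tensor set"
  where "symmetric_tensors = {T. \<forall>\<pi>. \<pi> permutes UNIV \<longrightarrow> (\<forall>I. T $ (I \<circ> \<pi>) = T $ I)}"

definition segre :: "('k::field, 'n::finite, 'd::finite) tensor set set"
  where "segre = {proj_class (pure_tensor v) | v. \<forall>j. v j \<noteq> 0}"

definition veronese :: "('k::field, 'n::finite, 'd::finite) tensor set set"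
  where "veronese = {proj_class (pure_tensor (\<lambda>_. v)) | v. v \<noteq> 0}"

definition sigma2_veronese :: "('k::field, 'n::finite, 'd::finite) tensor set set"
  where "sigma2_veronese =
    zariski_closure_in symmetric_tensors
      (\<Union>{proj_span {A, B} | A B. A \<in> veronese \<and> B \<in> veronese \<and> A \<noteq> B})"

end

theory Submission
  imports Defs
begin

text \<open>
  The \<open>3 \<times> 3\<close> minors of the flattenings vanish on all secant lines, hence on
  \<open>\<sigma>\<^sub>2\<close>. Conversely, the minors of the \<open>(1, d - 1)\<close> flattening make \<open>T\<close>
  a binary form, and those of its Hankel matrix give a linear recurrence of order two for its
  coefficients. If the characteristic roots differ, \<open>T\<close> is a combination of two powers; then
  the ranks agree because a symmetric tensor of tensor rank one is a multiple of a power. If they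
  coincide, \<open>T\<close> is a tangent vector \<open>\<Sum>\<^sub>j u \<otimes> \<dots> \<otimes> x \<otimes> \<dots> \<otimes> u\<close>. Such a
  tensor is a sum of \<open>d\<close> powers, by averaging \<open>(u + z x)\<^sup>d\<close> over the \<open>d\<close>-th roots of unity
  \<open>z\<close>, while the substitution method shows that it has tensor rank at least \<open>d\<close>.
\<close>

(* Otherwise every vector component is ambiguous, and parsing time is exponential in their number. *)
no_notation fps_nth (infixl "$" 75)

subsection \<open>Products, roots of unity and recurrences\<close>

text \<open>The set \<open>A\<close> records the slots in which the second summand is chosen.
  Applied to coordinates, this expands the power of \<open>e + r *s f\<close> with weights that
  depend on \<open>A\<close> only through \<open>card A\<close>.\<close>

lemma prod_add_smult_expand:
  fixes x y :: "'d::finite \<Rightarrow> 'a::comm_ring_1"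
  shows "(\<Prod>j\<in>UNIV. x j + r * y j)
       = (\<Sum>A\<in>UNIV. r ^ card A * ((\<Prod>j\<in>A. y j) * (\<Prod>j\<in>-A. x j)))"
proof -
  have "(\<Prod>j\<in>UNIV. x j + r * y j) = (\<Prod>j\<in>UNIV. r * y j + x j)"
    by (simp add: add.commute)
  also have "\<dots> = (\<Sum>A\<in>UNIV. r ^ card A * ((\<Prod>j\<in>A. y j) * (\<Prod>j\<in>-A. x j)))"
    by (subst prod_add)
       (simp_all add: prod.distrib prod_constant Compl_eq_Diff_UNIV mult.assoc)
  finally show ?thesis .
qed

text \<open>This is the derivative in \<open>r\<close> of the preceding expansion, obtained by
  counting pairs \<open>j \<in> A\<close>. The truncated exponent at \<open>A = {}\<close> is
  harmless because the factor \<open>card A\<close> vanishes there. It yields the coordinates of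
  tangent tensors.\<close>

lemma sum_prod_add_smult_expand:
  fixes x y :: "'d::finite \<Rightarrow> 'a::comm_ring_1"
  shows "(\<Sum>j\<in>UNIV. y j * (\<Prod>l\<in>-{j}. x l + r * y l))
       = (\<Sum>A\<in>UNIV. of_nat (card A) * r ^ (card A - 1) * ((\<Prod>j\<in>A. y j) * (\<Prod>j\<in>-A. x j)))"
proof -
  define m where "m A = (\<Prod>j\<in>A. y j) * (\<Prod>j\<in>-A. x j)" for A
  have one: "y j * (\<Prod>l\<in>-{j}. x l + r * y l) = (\<Sum>A | j \<in> A. r ^ (card A - 1) * m A)" for j
  proof -
    have "(\<Prod>l\<in>-{j}. x l + r * y l) = (\<Prod>l\<in>-{j}. r * y l + x l)"
      by (simp add: add.commute)
    also have "\<dots> = (\<Sum>X\<in>Pow (-{j}). r ^ card X * ((\<Prod>l\<in>X. y l) * (\<Prod>l\<in>-{j}-X. x l)))"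
      by (subst prod_add) (simp_all add: prod.distrib prod_constant mult.assoc)
    finally have "y j * (\<Prod>l\<in>-{j}. x l + r * y l)
        = (\<Sum>X\<in>Pow (-{j}). y j * (r ^ card X * ((\<Prod>l\<in>X. y l) * (\<Prod>l\<in>-{j}-X. x l))))"
      by (simp add: sum_distrib_left)
    also have "\<dots> = (\<Sum>A | j \<in> A. r ^ (card A - 1) * m A)"
    \<comment> \<open>A choice \<open>X\<close> among the slots other than \<open>j\<close> becomes
      the set \<open>insert j X\<close>, so \<open>card X\<close> turns into
      \<open>card A - 1\<close>.\<close>
    proof (rule sum.reindex_bij_witness[where i = "\<lambda>A. A - {j}" and j = "insert j"])
      fix X assume "X \<in> Pow (-{j})"
      then have X: "j \<notin> X" by auto
      have "-{j} - X = - insert j X" by auto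
      then show "r ^ (card (insert j X) - 1) * m (insert j X)
          = y j * (r ^ card X * ((\<Prod>l\<in>X. y l) * (\<Prod>l\<in>-{j}-X. x l)))"
        using X by (simp add: m_def algebra_simps)
    qed auto
    finally show ?thesis .
  qed
  have "(\<Sum>j\<in>UNIV. y j * (\<Prod>l\<in>-{j}. x l + r * y l))
      = (\<Sum>j\<in>UNIV. \<Sum>A | A \<in> UNIV \<and> j \<in> A. r ^ (card A - 1) * m A)"
    by (simp add: one)
  also have "\<dots> = (\<Sum>A\<in>UNIV. \<Sum>j | j \<in> UNIV \<and> j \<in> A. r ^ (card A - 1) * m A)"
    by (rule sum.swap_restrict) auto
  also have "\<dots> = (\<Sum>A\<in>UNIV. of_nat (card A) * r ^ (card A - 1) * m A)"
    by (simp add: mult.assoc)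
  finally show ?thesis by (simp add: m_def)
qed

text \<open>Over an algebraically closed field \<open>z ^ d - 1\<close> splits into \<open>d\<close>
  linear factors. A repeated root would be a zero of the derivative \<open>d * z ^ (d - 1)\<close>,
  hence \<open>0\<close> in characteristic zero, and \<open>0\<close> is not a root.\<close>

lemma card_unity_roots:
  assumes "d > 0"
  shows "card {z :: 'k::{alg_closed_field, field_char_0}. z ^ d = 1} = d"
proof -
  define p :: "'k poly" where "p = monom 1 d - 1"
  have deg: "degree p = d"
    using assms unfolding p_def
    by (intro antisym degree_le le_degree) (auto simp: coeff_eq_0)
  have lead: "lead_coeff p = 1"
    using assms by (simp add: deg) (simp add: p_def)
  have val: "poly p z = z ^ d - 1" for z
    by (simp add: p_def poly_monom)
  obtain M where M: "size M = d" "p = (\<Prod>x\<in>#M. [:-x, 1:])"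
    using alg_closed_imp_factorization[of p] deg assms lead by fastforce
  have roots: "set_mset M = {z. z ^ d = 1}"
  proof -
    have "poly p z = (\<Prod>x\<in>#M. z - x)" for z
      unfolding M(2) by (induction M) (auto simp: algebra_simps)
    then have "poly p z = 0 \<longleftrightarrow> z \<in># M" for z
      by auto
    then show ?thesis by (auto simp: val)
  qed
  have simple: "count M x = 1" if x: "x \<in># M" for x
  proof (rule ccontr)
    assume "count M x \<noteq> 1"
    obtain N where N: "M = add_mset x N"
      using x by (meson mset_add)
    with \<open>count M x \<noteq> 1\<close> have "x \<in># N"
      by (simp add: count_eq_zero_iff)
    then obtain N' where "N = add_mset x N'"
      by (meson mset_add)
    with N M(2) have "p = [:-x, 1:] * ([:-x, 1:] * (\<Prod>x\<in>#N'. [:-x, 1:]))"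
      by simp
    then have "poly (pderiv p) x = 0"
      by (simp only: pderiv_mult poly_add poly_mult) simp
    moreover have "pderiv p = monom (of_nat d) (d - 1)"
      by (simp add: p_def pderiv_diff pderiv_monom)
    ultimately have "x ^ (d - 1) = 0"
      using assms by (simp add: poly_monom)
    moreover have "x ^ d = 1" using roots x by auto
    ultimately show False using assms by (cases d) auto
  qed
  have "card (set_mset M) = (\<Sum>x\<in>set_mset M. count M x)"
    using simple by simp
  then show ?thesis
    using M(1) roots by (simp add: size_multiset_overloaded_eq)
qed

text \<open>Multiplication by a root \<open>w\<close> permutes the roots and scales the sum by
  \<open>w ^ m\<close>; the sum therefore vanishes as soon as \<open>w ^ m \<noteq> 1\<close> for
  some \<open>w\<close>.\<close>

lemma sum_unity_roots_power:
  fixes R :: "'k::{alg_closed_field, field_char_0} set"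
  assumes "d > 0" and R: "R = {z. z ^ d = 1}"
  shows "(\<Sum>z\<in>R. z ^ m) = (if d dvd m then of_nat d else 0)"
proof (cases "d dvd m")
  case True
  then have "z ^ m = 1" if "z \<in> R" for z
    using that by (auto simp: R power_mult)
  then show ?thesis
    using True card_unity_roots[OF assms(1), where 'k='k] by (simp add: R)
next
  case False
  have red: "z ^ m = z ^ (m mod d)" if "z \<in> R" for z
  proof -
    have "z ^ m = z ^ (d * (m div d) + m mod d)" by simp
    also have "\<dots> = z ^ (m mod d)"
      using that unfolding power_add power_mult by (simp add: R)
    finally show ?thesis .
  qed
  have pos: "m mod d > 0" using False by (simp add: dvd_eq_mod_eq_0)
  \<comment> \<open>Only \<open>m mod d < d\<close> elements have \<open>m mod d\<close>-th power
    \<open>1\<close>, too few to include all \<open>d\<close> elements of \<open>R\<close>.\<close>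
  have "\<exists>w\<in>R. w ^ (m mod d) \<noteq> 1"
  proof (rule ccontr)
    assume "\<not> ?thesis"
    then have sub: "R \<subseteq> {z. z ^ (m mod d) = 1}" by auto
    have "finite {z::'k. z ^ (m mod d) = 1}"
      using pos card_unity_roots[of "m mod d", where 'k='k] by (metis card.infinite less_irrefl)
    from card_mono[OF this sub] show False
      using card_unity_roots[OF assms(1), where 'k='k] card_unity_roots[OF pos, where 'k='k]
        mod_less_divisor[OF assms(1), of m] by (simp add: R)
  qed
  then obtain w where w: "w \<in> R" "w ^ m \<noteq> 1" using red by auto
  then have w0: "w \<noteq> 0" using assms by (auto simp: R power_0_left)
  have "(\<Sum>z\<in>R. z ^ m) = (\<Sum>z\<in>R. (w * z) ^ m)"
    using w w0 by (intro sum.reindex_bij_witness[where j = "\<lambda>z. z / w" and i = "\<lambda>z. w * z"])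
      (auto simp: R power_mult_distrib power_divide)
  also have "\<dots> = w ^ m * (\<Sum>z\<in>R. z ^ m)"
    by (simp add: power_mult_distrib sum_distrib_left)
  finally show ?thesis using w False by auto
qed

text \<open>The solutions come from the roots of the characteristic polynomial. For a double root
  the second solution is the derivative of \<open>r ^ k\<close> in \<open>r\<close>; unlike
  \<open>k * r ^ k\<close>, it does not degenerate when \<open>r = 0\<close>.\<close>

lemma order2_recurrence_solution:
  fixes c :: "nat \<Rightarrow> 'k::{alg_closed_field, field_char_0}"
  assumes "q2 \<noteq> 0"
    and rec: "\<And>k. k + 2 \<le> d \<Longrightarrow> q0 * c k + q1 * c (k + 1) + q2 * c (k + 2) = 0"
  shows "\<exists>a b r s. (\<forall>k\<le>d. c k = a * r ^ k + b * s ^ k)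
           \<or> (\<forall>k\<le>d. c k = a * r ^ k + b * (of_nat k * r ^ (k - 1)))"
proof -
  have "degree [:q0, q1, q2:] > 0" using assms(1) by simp
  then obtain r where r: "poly [:q0, q1, q2:] r = 0"
    using alg_closed_imp_poly_has_root by blast
  define s where "s = - q1 / q2 - r"
  have q1: "q1 = - q2 * (r + s)"
    using assms(1) by (simp add: s_def field_simps)
  have q0: "q0 = q2 * (r * s)"
    using r unfolding q1 by (simp add: algebra_simps eq_neg_iff_add_eq_0)
  have step: "c (Suc (Suc k)) = (r + s) * c (Suc k) - r * s * c k" if "k + 2 \<le> d" for k
  proof -
    have "q2 * (c (Suc (Suc k)) - ((r + s) * c (Suc k) - r * s * c k)) = 0"
      using rec[OF that] unfolding q0 q1 by (simp add: algebra_simps)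
    then show ?thesis using assms(1) by simp
  qed
  show ?thesis
  proof (cases "r = s")
    case False
    \<comment> \<open>The constants solve \<open>a + b = c 0\<close> and
      \<open>a * r + b * s = c 1\<close>.\<close>
    define b where "b = (c 1 - r * c 0) / (s - r)"
    define a where "a = c 0 - b"
    have b: "b * s = c 1 - r * c 0 + b * r" using False by (simp add: b_def field_simps)
    have "c k = a * r ^ k + b * s ^ k" if "k \<le> d" for k
      using that
    proof (induction k rule: induct_nat_012)
      case 1
      then show ?case using b by (simp add: a_def algebra_simps)
    next
      case (ge2 k)
      then show ?case using step[of k] by (simp add: algebra_simps)
    qed (simp add: a_def)
    then show ?thesis by blast
  next
    case True
    define b where "b = c 1 - r * c 0"
    have c1: "c (Suc 0) = r * c 0 + b" by (simp add: b_def)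
    obtain a where a: "c 0 = a" by blast
    have "c k = a * r ^ k + b * (of_nat k * r ^ (k - 1))" if "k \<le> d" for k
      using that
    proof (induction k rule: induct_nat_012)
      case (ge2 k)
      have "c (Suc (Suc k)) = 2 * r * c (Suc k) - r * r * c k"
        using step[of k] ge2.prems True by simp
      also have "\<dots> = 2 * r * (a * r ^ Suc k + b * (of_nat (Suc k) * r ^ k))
          - r * r * (a * r ^ k + b * (of_nat k * r ^ (k - 1)))"
        using ge2 by simp
      \<comment> \<open>The case \<open>k = 0\<close> is separate because \<open>k - 1\<close> is
        truncated there.\<close>
      also have "\<dots> = a * r ^ Suc (Suc k) + b * (of_nat (Suc (Suc k)) * r ^ (Suc (Suc k) - 1))"
        by (cases k) (simp_all add: algebra_simps)
      finally show ?case .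
    qed (simp_all add: a c1)
    then show ?thesis by blast
  qed
qed

subsection \<open>Rank two and symmetric tensors\<close>

definition minor3 :: "('r \<Rightarrow> 's \<Rightarrow> 'a::comm_ring_1) \<Rightarrow> 'r \<Rightarrow> 'r \<Rightarrow> 'r \<Rightarrow> 's \<Rightarrow> 's \<Rightarrow> 's \<Rightarrow> 'a"
  where "minor3 M i j k x y z
    = M i x * M j y * M k z - M i x * M j z * M k y - M i y * M j x * M k z
    + M i y * M j z * M k x + M i z * M j x * M k y - M i z * M j y * M k x"

lemma minor3_rank2:
  "minor3 (\<lambda>i x. u i * v x + u' i * v' x) i j k x y z = 0"
  unfolding minor3_def by (simp add: algebra_simps)

text \<open>If some 2 by 2 minor \<open>?D\<close> is nonzero, expanding the vanishing 3 by 3 minor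
  along the column \<open>x\<close> is Cramer's rule for the rows \<open>p\<close> and
  \<open>q\<close>. Otherwise every row is a multiple of one nonzero row, or all rows vanish, and
  \<open>p = q\<close> is taken.\<close>

lemma rank2_rows:
  fixes M :: "'r \<Rightarrow> 's \<Rightarrow> 'a::field"
  assumes "R \<noteq> {}"
    and minors: "\<And>i j k x y z. \<lbrakk>i \<in> R; j \<in> R; k \<in> R; x \<in> S; y \<in> S; z \<in> S\<rbrakk>
      \<Longrightarrow> minor3 M i j k x y z = 0"
  shows "\<exists>p\<in>R. \<exists>q\<in>R. \<exists>e f. \<forall>i\<in>R. \<forall>x\<in>S. M i x = M p x * e i + M q x * f i"
proof (cases "\<exists>p\<in>R. \<exists>q\<in>R. \<exists>y\<in>S. \<exists>z\<in>S. M p y * M q z - M p z * M q y \<noteq> 0")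
  case True
  then obtain p q y z where pq: "p \<in> R" "q \<in> R" "y \<in> S" "z \<in> S"
    and nz: "M p y * M q z - M p z * M q y \<noteq> 0" (is "?D \<noteq> 0") by blast
  have "M i x = M p x * ((M i y * M q z - M i z * M q y) / ?D)
              + M q x * ((M p y * M i z - M p z * M i y) / ?D)" if "i \<in> R" "x \<in> S" for i x
  proof -
    have "M i x * ?D = M p x * (M i y * M q z - M i z * M q y)
                     + M q x * (M p y * M i z - M p z * M i y)"
      using minors[OF that(1) pq(1,2) that(2) pq(3,4)]
      unfolding minor3_def by (simp add: algebra_simps)
    then have "M i x = (M p x * (M i y * M q z - M i z * M q y)
                     + M q x * (M p y * M i z - M p z * M i y)) / ?D"
      by (rule nonzero_eq_divide_eq[OF nz, THEN iffD2])
    then show ?thesis by (simp only: add_divide_distrib times_divide_eq_right)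
  qed
  then have "\<exists>e f. \<forall>i\<in>R. \<forall>x\<in>S. M i x = M p x * e i + M q x * f i"
    by (intro exI[of _ "\<lambda>i. (M i y * M q z - M i z * M q y) / ?D"]
        exI[of _ "\<lambda>i. (M p y * M i z - M p z * M i y) / ?D"]) simp
  with pq show ?thesis by auto
next
  case False
  show ?thesis
  proof (cases "\<exists>p\<in>R. \<exists>y\<in>S. M p y \<noteq> 0")
    case True
    then obtain p y where py: "p \<in> R" "y \<in> S" "M p y \<noteq> 0" by blast
    have "M i x = M p x * (M i y / M p y) + M p x * 0" if "i \<in> R" "x \<in> S" for i x
    proof -
      have "M p y * M i x - M p x * M i y = 0"
        using False that py by blast
      then show ?thesis using py(3) by (simp add: field_simps)
    qed
    then have "\<exists>e f. \<forall>i\<in>R. \<forall>x\<in>S. M i x = M p x * e i + M p x * f i"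
      by (intro exI[of _ "\<lambda>i. M i y / M p y"] exI[of _ "\<lambda>_. 0"]) simp
    with py show ?thesis by auto
  next
    case zero: False
    obtain p where "p \<in> R" using assms(1) by blast
    with zero show ?thesis by auto
  qed
qed

text \<open>Two of the three rows span all of them, so a row \<open>i\<close> other than
  \<open>p\<close> and \<open>q\<close> satisfies a nontrivial relation. For a Hankel matrix, such a
  relation among the rows is a recurrence for its entries.\<close>

lemma three_rows_dependent:
  fixes M :: "nat \<Rightarrow> 's \<Rightarrow> 'a::field"
  assumes minors: "\<And>i j k x y z. \<lbrakk>i < 3; j < 3; k < 3; x \<in> S; y \<in> S; z \<in> S\<rbrakk>
      \<Longrightarrow> minor3 M i j k x y z = 0"
  shows "\<exists>a0 a1 a2. (a0 \<noteq> 0 \<or> a1 \<noteq> 0 \<or> a2 \<noteq> 0)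
    \<and> (\<forall>x\<in>S. a0 * M 0 x + a1 * M 1 x + a2 * M 2 x = 0)"
proof -
  have ne: "{..<3::nat} \<noteq> {}" by (simp add: lessThan_empty_iff)
  have "minor3 M i j k x y z = 0"
    if "i \<in> {..<3}" "j \<in> {..<3}" "k \<in> {..<3}" "x \<in> S" "y \<in> S" "z \<in> S" for i j k x y z
    using minors that by simp
  from rank2_rows[where S = S, OF ne this] obtain p q :: nat and e f where pq: "p \<in> {..<3}" "q \<in> {..<3}"
    and rel: "\<forall>i\<in>{..<3}. \<forall>x\<in>S. M i x = M p x * e i + M q x * f i"
    by auto
  have "\<exists>i<3. i \<noteq> p \<and> i \<noteq> q" by presburger
  then obtain i where i: "i < 3" "i \<noteq> p" "i \<noteq> q" by blast
  \<comment> \<open>Separate summands keep the formula correct when \<open>p = q\<close>; the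
    coefficient at \<open>i\<close> is \<open>1\<close> in any case.\<close>
  define a where "a l = (if l = i then 1 else 0) - (if l = p then e i else 0)
    - (if l = q then f i else 0)" for l
  have "a 0 * M 0 x + a 1 * M 1 x + a 2 * M 2 x = 0" if "x \<in> S" for x
  proof -
    have "(\<Sum>l<3. a l * M l x) = M i x - e i * M p x - f i * M q x"
      using i pq by (simp add: a_def left_diff_distrib sum_subtractf if_distrib[of "\<lambda>t. t * _"]
          cong: if_cong)
    also have "\<dots> = 0" using rel i that by simp
    finally show ?thesis by (simp add: eval_nat_numeral)
  qed
  moreover have "a i \<noteq> 0" using i by (simp add: a_def)
  then have "a 0 \<noteq> 0 \<or> a 1 \<noteq> 0 \<or> a 2 \<noteq> 0"
    using i(1) by (auto simp: less_Suc_eq eval_nat_numeral)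
  ultimately show ?thesis by blast
qed

section \<open>Coordinates of symmetric tensors\<close>

lemma symmetric_tensor_permute:
  assumes "T \<in> symmetric_tensors" "bij \<pi>"
  shows "T $ (I \<circ> \<pi>) = T $ I"
proof -
  have "\<pi> permutes UNIV" using assms(2) by (intro bij_imp_permutes) auto
  then show ?thesis using assms(1) unfolding symmetric_tensors_def by blast
qed

text \<open>Bijections from \<open>A\<close> to \<open>B\<close> and between their complements glue
  to a permutation of the slots that carries one index to the other.\<close>

lemma symmetric_tensor_two_valued:
  fixes T :: "('k::field, 'n::finite, 'd::finite) tensor"
  assumes T: "T \<in> symmetric_tensors" and card: "card A = card B"
  shows "T $ (\<lambda>l. if l \<in> A then q else p) = T $ (\<lambda>l. if l \<in> B then q else p)"
proof -
  have "card (-A) = card (-B)"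
    using card by (simp add: Compl_eq_Diff_UNIV card_Diff_subset)
  then obtain f g where f: "bij_betw f A B" and g: "bij_betw g (-A) (-B)"
    using card by (metis finite finite_same_card_bij)
  define \<pi> where "\<pi> l = (if l \<in> A then f l else g l)" for l
  have "bij_betw \<pi> (A \<union> -A) (B \<union> -B)"
  proof (rule bij_betw_combine)
    show "bij_betw \<pi> A B" using f by (subst bij_betw_cong[where g = f]) (auto simp: \<pi>_def)
    show "bij_betw \<pi> (-A) (-B)" using g by (subst bij_betw_cong[where g = g]) (auto simp: \<pi>_def)
  qed auto
  then have "bij \<pi>" by simp
  moreover have "\<pi> l \<in> B \<longleftrightarrow> l \<in> A" for l
    using bij_betwE[OF f] bij_betwE[OF g] by (auto simp: \<pi>_def)
  then have "(\<lambda>l. if l \<in> B then q else p) \<circ> \<pi> = (\<lambda>l. if l \<in> A then q else p)"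
    by (simp add: fun_eq_iff)
  ultimately show ?thesis
    using symmetric_tensor_permute[OF T, of \<pi> "\<lambda>l. if l \<in> B then q else p"] by simp
qed

text \<open>
  Symmetry moves the relation from the slot \<open>j\<^sub>0\<close> to every slot; expanding all
  slots writes \<open>T\<close> in terms of its coordinates with indices \<open>p\<close> and \<open>q\<close> only.
\<close>
lemma symmetric_tensor_expand:
  fixes T :: "('k::field, 'n::finite, 'd::finite) tensor" and e f :: "'k ^ 'n"
  assumes T: "T \<in> symmetric_tensors"
    and fibre: "\<And>J i. T $ (J(j0 := i)) = T $ (J(j0 := p)) * e $ i + T $ (J(j0 := q)) * f $ i"
  shows "T $ I = (\<Sum>A\<in>UNIV. T $ (\<lambda>l. if l \<in> A then q else p)
           * ((\<Prod>j\<in>A. f $ I j) * (\<Prod>j\<in>-A. e $ I j)))"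
proof -
  have slot: "T $ (J(j := i)) = T $ (J(j := p)) * e $ i + T $ (J(j := q)) * f $ i" for J j i
  proof -
    \<comment> \<open>Exchanging \<open>j0\<close> and \<open>j\<close> moves the varying entry to
      slot \<open>j0\<close>. The coefficients in \<open>fibre\<close> do not depend on the
      remaining entries, so the same relation results.\<close>
    have "T $ (J(j := i')) = T $ ((J \<circ> Transposition.transpose j0 j)(j0 := i'))" for i'
    proof -
      have "J(j := i') \<circ> Transposition.transpose j0 j = (J \<circ> Transposition.transpose j0 j)(j0 := i')"
        by (auto simp: fun_eq_iff Transposition.transpose_def)
      then show ?thesis
        using symmetric_tensor_permute[OF T, of "Transposition.transpose j0 j" "J(j := i')"] by simp
    qed
    then show ?thesis using fibre by metis
  qed
  \<comment> \<open>This index arises when the slots in \<open>D\<close> have been expanded: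
    \<open>q\<close> on \<open>A\<close>, \<open>p\<close> on the rest of \<open>D\<close>, and
    still \<open>I\<close> outside.\<close>
  define K where "K D A l = (if l \<in> A then q else if l \<in> D then p else I l)" for D A l
  have "T $ I = (\<Sum>A\<in>Pow D. T $ K D A * ((\<Prod>j\<in>A. f $ I j) * (\<Prod>j\<in>D-A. e $ I j)))" for D
  proof (induction D rule: finite_induct[OF finite])
    case 1
    then show ?case by (simp add: K_def)
  next
    case (2 x D)
    let ?t = "\<lambda>D A. T $ K D A * ((\<Prod>j\<in>A. f $ I j) * (\<Prod>j\<in>D-A. e $ I j))"
    have split: "?t D A = ?t (insert x D) A + ?t (insert x D) (insert x A)" if "A \<subseteq> D" for A
    proof -
      have x: "x \<notin> A" using that 2 by auto
      have "K D A = (K D A)(x := I x)" "(K D A)(x := p) = K (insert x D) A"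
        "(K D A)(x := q) = K (insert x D) (insert x A)"
        using 2 x by (auto simp: K_def fun_eq_iff)
      then have "T $ K D A = T $ K (insert x D) A * e $ I x + T $ K (insert x D) (insert x A) * f $ I x"
        using slot[of "K D A" x "I x"] by simp
      moreover have "insert x D - A = insert x (D - A)" "insert x D - insert x A = D - A"
        using 2 x by auto
      ultimately show ?thesis using 2 x by (simp add: algebra_simps)
    qed
    have "(\<Sum>A\<in>Pow (insert x D). ?t (insert x D) A)
        = (\<Sum>A\<in>Pow D. ?t (insert x D) A) + (\<Sum>A\<in>insert x ` Pow D. ?t (insert x D) A)"
      unfolding Pow_insert by (rule sum.union_disjoint) (use 2 in auto)
    also have "(\<Sum>A\<in>insert x ` Pow D. ?t (insert x D) A) = (\<Sum>A\<in>Pow D. ?t (insert x D) (insert x A))"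
      using 2 by (subst sum.reindex) (auto simp: inj_on_def)
    finally show ?case
      using 2(3) split by (simp add: sum.distrib)
  qed
  from this[of UNIV] show ?thesis
    by (simp only: K_def[abs_def] UNIV_I if_True Compl_eq_Diff_UNIV Pow_UNIV)
qed

text \<open>The slices of a pure tensor in one slot are all multiples of a single slice. Hence
  \<open>symmetric_tensor_expand\<close> applies with second vector \<open>0\<close>, and only the
  term \<open>A = {}\<close> survives: a multiple of the power of \<open>e\<close>.\<close>

lemma rank1_symmetric_tensor:
  fixes v :: "'d::finite \<Rightarrow> 'k::field ^ 'n::finite"
  assumes sym: "pure_tensor v \<in> symmetric_tensors"
  obtains a u where "pure_tensor v = a *s pure_tensor (\<lambda>_. u)"
proof (cases "pure_tensor v = 0")
  case True
  then have "pure_tensor v = 0 *s pure_tensor (\<lambda>_. 0)" by simp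
  then show ?thesis by (rule that)
next
  case False
  define j0 where "j0 = (undefined :: 'd)"
  obtain I where "pure_tensor v $ I \<noteq> 0" using False by (auto simp: vec_eq_iff)
  then have nz: "v j0 $ I j0 \<noteq> 0" by (auto simp: pure_tensor_def)
  define p where "p = I j0"
  define e where "e = (\<chi> i. v j0 $ i / v j0 $ p)"
  have fibre: "pure_tensor v $ (J(j0 := i)) = pure_tensor v $ (J(j0 := p)) * e $ i
      + pure_tensor v $ (J(j0 := p)) * (0 :: 'k ^ 'n) $ i" for J i
  proof -
    have "pure_tensor v $ (J(j0 := i')) = v j0 $ i' * (\<Prod>j\<in>UNIV-{j0}. v j $ J j)" for i'
      unfolding pure_tensor_def
      by (subst vec_lambda_beta, subst prod.remove[of _ j0]) auto
    then show ?thesis using nz by (simp add: e_def p_def)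
  qed
  have "pure_tensor v $ L = pure_tensor v $ (\<lambda>_. p) * (\<Prod>j\<in>UNIV. e $ L j)" for L
  proof -
    have "pure_tensor v $ L = (\<Sum>A\<in>UNIV. pure_tensor v $ (\<lambda>l. if l \<in> A then p else p)
        * ((\<Prod>j\<in>A. (0 :: 'k ^ 'n) $ L j) * (\<Prod>j\<in>-A. e $ L j)))"
      by (rule symmetric_tensor_expand[OF sym fibre])
    also have "\<dots> = (\<Sum>A\<in>(UNIV :: 'd set set). if A = {} then pure_tensor v $ (\<lambda>_. p) * (\<Prod>j\<in>UNIV. e $ L j) else 0)"
      by (rule sum.cong) (auto simp: zero_power card_gt_0_iff)
    finally show ?thesis by simp
  qed
  note coord = this
  have "pure_tensor v = (pure_tensor v $ (\<lambda>_. p)) *s pure_tensor (\<lambda>_. e)"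
  proof (rule vec_eq_iff[THEN iffD2], rule allI)
    fix L
    show "pure_tensor v $ L = ((pure_tensor v $ (\<lambda>_. p)) *s pure_tensor (\<lambda>_. e)) $ L"
      using coord[of L] by (simp add: pure_tensor_def[of "\<lambda>_. e"])
  qed
  then show ?thesis by (rule that)
qed

subsection \<open>Binary forms and tangent tensors\<close>

definition tangent_tensor :: "'k::field ^ 'n::finite \<Rightarrow> 'k ^ 'n \<Rightarrow> ('k, 'n, 'd::finite) tensor"
  where "tangent_tensor u x = (\<Sum>j\<in>UNIV. pure_tensor ((\<lambda>_. u)(j := x)))"

lemma prod_slot:
  fixes g :: "'a \<Rightarrow> 'd::finite \<Rightarrow> 'b::comm_monoid_mult"
  shows "(\<Prod>l\<in>UNIV. g (((\<lambda>_. u)(j := x)) l) l) = g x j * (\<Prod>l\<in>-{j}. g u l)"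
proof -
  have "(\<Prod>l\<in>UNIV. g (((\<lambda>_. u)(j := x)) l) l)
      = g x j * (\<Prod>l\<in>UNIV-{j}. g (((\<lambda>_. u)(j := x)) l) l)"
    by (subst prod.remove[of _ j]) auto
  also have "(\<Prod>l\<in>UNIV-{j}. g (((\<lambda>_. u)(j := x)) l) l) = (\<Prod>l\<in>-{j}. g u l)"
    by (rule prod.cong) auto
  finally show ?thesis .
qed

lemma tangent_tensor_nth:
  "tangent_tensor u x $ I = (\<Sum>j\<in>UNIV. x $ I j * (\<Prod>l\<in>-{j}. u $ I l))"
  by (simp add: tangent_tensor_def pure_tensor_def sum_component prod_slot[of "\<lambda>y l. y $ I l"]
      del: fun_upd_apply)

lemma pure_tensor_const_nth: "pure_tensor (\<lambda>_. u) $ I = (\<Prod>j\<in>UNIV. u $ I j)"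
  by (simp add: pure_tensor_def)

text \<open>Linearity in the direction, together with the fact that the direction \<open>u\<close>
  gives \<open>CARD('d)\<close> copies of the power of \<open>u\<close>. It allows a multiple of
  that power to be absorbed into the tangent direction.\<close>

lemma tangent_tensor_parallel:
  "tangent_tensor u (b *s x + a *s u)
     = b *s tangent_tensor u x + (a * of_nat CARD('d)) *s (pure_tensor (\<lambda>_. u) :: ('k::field, 'n::finite, 'd::finite) tensor)"
proof (rule vec_eq_iff[THEN iffD2], rule allI)
  fix I :: "'d \<Rightarrow> 'n"
  have "u $ I j * (\<Prod>l\<in>-{j}. u $ I l) = (\<Prod>l\<in>UNIV. u $ I l)" for j
    using prod_slot[of "\<lambda>y l. y $ I l" u j u] by (simp add: fun_upd_idem)
  then show "tangent_tensor u (b *s x + a *s u) $ I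
     = (b *s tangent_tensor u x + (a * of_nat CARD('d)) *s (pure_tensor (\<lambda>_. u))) $ I"
    by (simp add: tangent_tensor_nth pure_tensor_const_nth distrib_right sum.distrib
        mult.assoc sum_distrib_left[symmetric])
qed

text \<open>Points on secant lines or on tangent lines. Zero or parallel vectors are allowed here
  and are sorted out when the ranks are compared.\<close>

definition two_powers_or_tangent :: "('k::field, 'n::finite, 'd::finite) tensor \<Rightarrow> bool"
  where "two_powers_or_tangent T \<longleftrightarrow>
    (\<exists>a b u w. T = a *s pure_tensor (\<lambda>_. u) + b *s pure_tensor (\<lambda>_. w))
    \<or> (\<exists>u x. T = tangent_tensor u x)"

text \<open>The coefficient sequence \<open>r ^ k\<close> belongs to the power of
  \<open>e + r *s f\<close>, and \<open>k * r ^ (k - 1)\<close> to the tangent tensor at that vector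
  in direction \<open>f\<close>. The two shapes of solutions of the recurrence thus give the two
  alternatives.\<close>

lemma binary_form_recurrence:
  fixes T :: "('k::{alg_closed_field, field_char_0}, 'n::finite, 'd::finite) tensor"
    and e f :: "'k ^ 'n"
  assumes T: "\<And>I. T $ I = (\<Sum>A\<in>UNIV. c (card A) * ((\<Prod>j\<in>A. f $ I j) * (\<Prod>j\<in>-A. e $ I j)))"
    and "q2 \<noteq> 0"
    and rec: "\<And>k. k + 2 \<le> CARD('d) \<Longrightarrow> q0 * c k + q1 * c (k + 1) + q2 * c (k + 2) = 0"
  shows "two_powers_or_tangent T"
proof -
  have card: "card A \<le> CARD('d)" for A :: "'d set"
    by (simp add: card_mono)
  have power: "pure_tensor (\<lambda>_. e + r *s f) $ I
      = (\<Sum>A\<in>UNIV. r ^ card A * ((\<Prod>j\<in>A. f $ I j) * (\<Prod>j\<in>-A. e $ I j)))" for r and I :: "'d \<Rightarrow> 'n"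
    by (simp add: pure_tensor_const_nth prod_add_smult_expand)
  from order2_recurrence_solution[OF assms(2) rec]
  obtain a b r s where "(\<forall>k\<le>CARD('d). c k = a * r ^ k + b * s ^ k)
           \<or> (\<forall>k\<le>CARD('d). c k = a * r ^ k + b * (of_nat k * r ^ (k - 1)))" by blast
  then show ?thesis
  proof
    assume c: "\<forall>k\<le>CARD('d). c k = a * r ^ k + b * s ^ k"
    have "T = a *s pure_tensor (\<lambda>_. e + r *s f) + b *s pure_tensor (\<lambda>_. e + s *s f)"
      by (rule vec_eq_iff[THEN iffD2])
        (simp add: T power c card sum_distrib_left sum.distrib[symmetric] distrib_right mult.assoc)
    then show ?thesis unfolding two_powers_or_tangent_def by blast
  next
    assume c: "\<forall>k\<le>CARD('d). c k = a * r ^ k + b * (of_nat k * r ^ (k - 1))"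
    let ?u = "e + r *s f"
    have tangent: "tangent_tensor ?u f $ I = (\<Sum>A\<in>UNIV. of_nat (card A) * r ^ (card A - 1)
        * ((\<Prod>j\<in>A. f $ I j) * (\<Prod>j\<in>-A. e $ I j)))" for I :: "'d \<Rightarrow> 'n"
      by (simp add: tangent_tensor_nth sum_prod_add_smult_expand)
    have "T = b *s tangent_tensor ?u f + a *s pure_tensor (\<lambda>_. ?u)"
      by (rule vec_eq_iff[THEN iffD2])
        (simp add: T power tangent c card sum_distrib_left sum.distrib[symmetric] algebra_simps)
    also have "\<dots> = tangent_tensor ?u (b *s f + (a / of_nat CARD('d)) *s ?u)"
      by (subst tangent_tensor_parallel) simp
    finally show ?thesis unfolding two_powers_or_tangent_def by blast
  qed
qed

text \<open>A vanishing leading coefficient means a characteristic root at infinity. If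
  \<open>q0 \<noteq> 0\<close>, exchanging \<open>e\<close> and \<open>f\<close> reverses the
  coefficients and moves that root away; otherwise the roots are \<open>0\<close> and infinity, and
  the two powers are those of \<open>e\<close> and \<open>f\<close>.\<close>

lemma binary_form_cases:
  fixes T :: "('k::{alg_closed_field, field_char_0}, 'n::finite, 'd::finite) tensor"
    and e f :: "'k ^ 'n"
  assumes T: "\<And>I. T $ I = (\<Sum>A\<in>UNIV. c (card A) * ((\<Prod>j\<in>A. f $ I j) * (\<Prod>j\<in>-A. e $ I j)))"
    and nz: "q0 \<noteq> 0 \<or> q1 \<noteq> 0 \<or> q2 \<noteq> 0"
    and rec: "\<And>k. k + 2 \<le> CARD('d) \<Longrightarrow> q0 * c k + q1 * c (k + 1) + q2 * c (k + 2) = 0"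
  shows "two_powers_or_tangent T"
proof -
  consider "q2 \<noteq> 0" | "q0 \<noteq> 0" | "q0 = 0" "q2 = 0" "q1 \<noteq> 0" using nz by blast
  then show ?thesis
  proof cases
    case 1
    then show ?thesis using binary_form_recurrence[OF T] rec by blast
  next
    case 2
    have compl: "card (-A) = CARD('d) - card A" "card A \<le> CARD('d)" for A :: "'d set"
      by (simp_all add: Compl_eq_Diff_UNIV card_Diff_subset card_mono)
    have swap: "T $ I = (\<Sum>A\<in>UNIV. c (CARD('d) - card A) * ((\<Prod>j\<in>A. e $ I j) * (\<Prod>j\<in>-A. f $ I j)))" for I
      unfolding T
      by (rule sum.reindex_bij_witness[where i = uminus and j = uminus])
        (auto simp: compl mult.commute)
    show ?thesis
    proof (rule binary_form_recurrence[OF swap 2])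
      fix k assume k: "k + 2 \<le> CARD('d)"
      then have "CARD('d) - k = (CARD('d) - (k + 2)) + 2" "CARD('d) - (k + 1) = (CARD('d) - (k + 2)) + 1"
        by simp_all
      then show "q2 * c (CARD('d) - k) + q1 * c (CARD('d) - (k + 1)) + q0 * c (CARD('d) - (k + 2)) = 0"
        using rec[of "CARD('d) - (k + 2)"] k by (simp add: algebra_simps)
    qed
  next
    case 3
    have mid: "c (card A) = 0" if "A \<noteq> {}" "A \<noteq> UNIV" for A :: "'d set"
    proof -
      have "card A > 0" using that by (simp add: card_gt_0_iff)
      moreover have "card A < CARD('d)" using that by (simp add: psubset_card_mono psubset_eq)
      ultimately show ?thesis using rec[of "card A - 1"] 3 by simp
    qed
    have "T = c 0 *s pure_tensor (\<lambda>_. e) + c CARD('d) *s pure_tensor (\<lambda>_. f)"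
    proof (rule vec_eq_iff[THEN iffD2], rule allI)
      fix I
      have "T $ I = (\<Sum>A\<in>(UNIV :: 'd set set). (if A = {} then c 0 * (\<Prod>j\<in>UNIV. e $ I j) else 0)
            + (if A = UNIV then c CARD('d) * (\<Prod>j\<in>UNIV. f $ I j) else 0))"
        unfolding T by (rule sum.cong) (auto simp: mid)
      then show "T $ I = (c 0 *s pure_tensor (\<lambda>_. e) + c CARD('d) *s pure_tensor (\<lambda>_. f)) $ I"
        by (simp add: sum.distrib pure_tensor_const_nth)
    qed
    then show ?thesis unfolding two_powers_or_tangent_def by blast
  qed
qed

text \<open>The weight \<open>z ^ (d - 1)\<close> filters out the part of the power of
  \<open>u + z *s x\<close> whose degree in \<open>z\<close> is congruent to \<open>1\<close> modulo
  \<open>d\<close>. Among the degrees \<open>0\<close> to \<open>d\<close> this leaves only the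
  linear part, which is the tangent tensor.\<close>

lemma tangent_tensor_eq_sum_powers:
  fixes u x :: "'k::{alg_closed_field, field_char_0} ^ 'n::finite"
  assumes d: "CARD('d) = d" "d \<ge> 2"
  shows "(tangent_tensor u x :: ('k, 'n, 'd::finite) tensor)
    = (\<Sum>z | z ^ d = 1. (z ^ (d - 1) / of_nat d) *s pure_tensor (\<lambda>_. u + z *s x))"
proof (rule vec_eq_iff[THEN iffD2], rule allI)
  fix I :: "'d \<Rightarrow> 'n"
  let ?m = "\<lambda>A. (\<Prod>j\<in>A. x $ I j) * (\<Prod>j\<in>-A. u $ I j)"
  have coeff: "(\<Sum>z | z ^ d = 1. z ^ (d - 1) / of_nat d * z ^ card A)
      = of_nat (card A) * (0::'k) ^ (card A - 1)" for A :: "'d set"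
  proof -
    have "card A \<le> d" using d(1) by (metis card_mono finite subset_UNIV)
    \<comment> \<open>The exponent lies between \<open>d - 1\<close> and \<open>2 * d - 1\<close>,
      and for \<open>d \<ge> 2\<close> the only multiple of \<open>d\<close> in this range is
      \<open>d\<close> itself.\<close>
    moreover have "card A = 1" if dvd: "d dvd d - 1 + card A" and le: "card A \<le> d"
    proof -
      obtain k where k: "d - 1 + card A = d * k" using dvd by (elim dvdE)
      consider "k = 0" | "k = 1" | "k \<ge> 2" by linarith
      then show ?thesis
      proof cases
        case 3
        then have "d * 2 \<le> d * k" by simp
        then show ?thesis using k le d(2) by linarith
      qed (use k d(2) in auto)
    qed
    ultimately have dvd: "d dvd d - 1 + card A \<longleftrightarrow> card A = 1" using d(2) by auto
    have "(\<Sum>z | z ^ d = 1. z ^ (d - 1) / of_nat d * z ^ card A)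
        = (\<Sum>z | z ^ d = 1. z ^ (d - 1 + card A)) / (of_nat d :: 'k)"
      by (simp add: sum_divide_distrib power_add)
    also have "\<dots> = (if card A = 1 then 1 else 0)"
    proof -
      have d0: "d > 0" using d(2) by simp
      show ?thesis
        by (simp only: sum_unity_roots_power[OF d0 refl] dvd) (use d0 in simp)
    qed
    \<comment> \<open>This form of the indicator matches \<open>sum_prod_add_smult_expand\<close> at
      \<open>r = 0\<close>.\<close>
    also have "(if n = 1 then 1 else 0) = of_nat n * (0::'k) ^ (n - 1)" for n
      by (auto simp: power_0_left)
    finally show ?thesis .
  qed
  have "tangent_tensor u x $ I = (\<Sum>A\<in>UNIV. of_nat (card A) * 0 ^ (card A - 1) * ?m A)"
    using sum_prod_add_smult_expand[of "\<lambda>j. x $ I j" "\<lambda>j. u $ I j" 0]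
    by (simp add: tangent_tensor_nth)
  also have "\<dots> = (\<Sum>A\<in>UNIV. \<Sum>z | z ^ d = 1. z ^ (d - 1) / of_nat d * z ^ card A * ?m A)"
    by (simp only: coeff[symmetric] sum_distrib_right)
  also have "\<dots> = (\<Sum>z | z ^ d = 1. \<Sum>A\<in>UNIV. z ^ (d - 1) / of_nat d * z ^ card A * ?m A)"
    by (rule sum.swap)
  also have "\<dots> = (\<Sum>z | z ^ d = 1. (z ^ (d - 1) / of_nat d) *s pure_tensor (\<lambda>_. u + z *s x)) $ I"
    by (simp add: sum_component pure_tensor_const_nth prod_add_smult_expand sum_distrib_left mult.assoc)
  finally show "tangent_tensor u x $ I
    = (\<Sum>z | z ^ d = 1. (z ^ (d - 1) / of_nat d) *s pure_tensor (\<lambda>_. u + z *s x)) $ I" .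
qed

section \<open>Lower bound for the tensor rank of tangent tensors\<close>

definition pairing :: "'k::field ^ 'n::finite \<Rightarrow> 'k ^ 'n \<Rightarrow> 'k"
  where "pairing \<phi> v = (\<Sum>i\<in>UNIV. v $ i * \<phi> $ i)"

lemma pairing_smult: "pairing \<phi> (c *s v) = c * pairing \<phi> v"
  by (simp add: pairing_def sum_distrib_left mult.assoc)

text \<open>Independence of \<open>u\<close> and \<open>v\<close> gives two coordinates with nonzero
  minor \<open>D\<close>; a functional supported on them is found by Cramer's rule.\<close>

lemma pairing_interpolate:
  assumes "u \<noteq> 0" and "\<And>c. v \<noteq> c *s u"
  shows "\<exists>\<phi>. pairing \<phi> u = \<alpha> \<and> pairing \<phi> v = \<beta>"
proof -
  obtain p where p: "u $ p \<noteq> 0" using assms(1) by (auto simp: vec_eq_iff)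
  obtain q where q: "v $ q \<noteq> (v $ p / u $ p) * u $ q"
    using assms(2)[of "v $ p / u $ p"] by (auto simp: vec_eq_iff)
  define D where "D = u $ p * v $ q - u $ q * v $ p"
  have D: "D \<noteq> 0" using p q by (simp add: D_def field_simps)
  define a where "a = (\<alpha> * v $ q - \<beta> * u $ q) / D"
  define b where "b = (\<beta> * u $ p - \<alpha> * v $ p) / D"
  define \<phi> where "\<phi> = (\<chi> i. (if i = p then a else 0) + (if i = q then b else 0))"
  have "pairing \<phi> y = y $ p * a + y $ q * b" for y
    by (simp add: pairing_def \<phi>_def distrib_left sum.distrib if_distrib[of "\<lambda>t. _ * t"] cong: if_cong)
  moreover have "(u $ p * a + u $ q * b) * D = \<alpha> * D" "(v $ p * a + v $ q * b) * D = \<beta> * D"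
    using D by (simp_all add: a_def b_def distrib_right) (simp_all add: D_def algebra_simps)
  ultimately show ?thesis using D by auto
qed

text \<open>
  The substitution method: contracting a factor with a functional that is \<open>1\<close> on \<open>u\<close> and kills
  one summand leaves a tensor of the same kind on one factor fewer, up to a multiple of the power
  of \<open>u\<close>, which \<open>\<gamma>\<close> absorbs.
\<close>
lemma tangent_form_rank:
  fixes v :: "'s \<Rightarrow> 'd \<Rightarrow> 'k::field ^ 'n::finite"
  assumes u: "u \<noteq> 0" and x: "\<And>c. x \<noteq> c *s u"
    and "finite D" "finite S"
    and "\<And>\<phi>. \<gamma> * (\<Prod>j\<in>D. pairing (\<phi> j) u) + (\<Sum>j\<in>D. pairing (\<phi> j) x * (\<Prod>l\<in>D-{j}. pairing (\<phi> l) u))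
      = (\<Sum>s\<in>S. a s * (\<Prod>j\<in>D. pairing (\<phi> j) (v s j)))"
  shows "card D \<le> card S"
  using assms(3-)
proof (induction D arbitrary: S \<gamma> a rule: finite_induct)
  case empty
  then show ?case by simp
next
  case (insert k D)
  let ?rest = "\<lambda>\<phi>. \<Sum>j\<in>D. pairing (\<phi> j) x * (\<Prod>l\<in>D-{j}. pairing (\<phi> l) u)"
  \<comment> \<open>Substituting \<open>\<phi>(k := \<psi>)\<close> isolates slot \<open>k\<close>:
    the summand \<open>j = k\<close> has \<open>x\<close> there, all others have
    \<open>u\<close>.\<close>
  have eq: "\<gamma> * (pairing \<psi> u * (\<Prod>j\<in>D. pairing (\<phi> j) u))
      + (pairing \<psi> x * (\<Prod>j\<in>D. pairing (\<phi> j) u) + pairing \<psi> u * ?rest \<phi>)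
      = (\<Sum>s\<in>S. a s * (pairing \<psi> (v s k) * (\<Prod>j\<in>D. pairing (\<phi> j) (v s j))))" for \<phi> \<psi>
  proof -
    have upd: "(\<Prod>j\<in>E. g j ((\<phi>(k := \<psi>)) j)) = (\<Prod>j\<in>E. g j (\<phi> j))" if "E \<subseteq> D" for E and g :: "'d \<Rightarrow> _ \<Rightarrow> 'k"
      using that insert.hyps by (intro prod.cong) auto
    have "(\<Sum>j\<in>D. pairing ((\<phi>(k := \<psi>)) j) x * (\<Prod>l\<in>insert k D-{j}. pairing ((\<phi>(k := \<psi>)) l) u))
        = (\<Sum>j\<in>D. pairing \<psi> u * (pairing (\<phi> j) x * (\<Prod>l\<in>D-{j}. pairing (\<phi> l) u)))"
    proof (rule sum.cong)
      fix j assume j: "j \<in> D"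
      with insert.hyps have "insert k D - {j} = insert k (D - {j})" "k \<notin> D - {j}" "j \<noteq> k" by auto
      then show "pairing ((\<phi>(k := \<psi>)) j) x * (\<Prod>l\<in>insert k D-{j}. pairing ((\<phi>(k := \<psi>)) l) u)
          = pairing \<psi> u * (pairing (\<phi> j) x * (\<Prod>l\<in>D-{j}. pairing (\<phi> l) u))"
        using insert.hyps upd[of "D - {j}" "\<lambda>_ t. pairing t u"] by simp
    qed simp
    then show ?thesis
      using insert.prems(2)[of "\<phi>(k := \<psi>)"] insert.hyps
        upd[of D "\<lambda>_ t. pairing t u"] upd[of D "\<lambda>j t. pairing t (v _ j)"]
      by (simp add: sum_distrib_left insert_Diff_if)
  qed
  show ?case
  proof (cases "\<exists>s\<in>S. \<forall>c. v s k \<noteq> c *s u")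
    case True
    then obtain s where s: "s \<in> S" "\<And>c. v s k \<noteq> c *s u" by blast
    obtain \<psi> where \<psi>: "pairing \<psi> u = 1" "pairing \<psi> (v s k) = 0"
      using pairing_interpolate[OF u s(2)] by blast
    have "card D \<le> card (S - {s})"
    proof (rule insert.IH)
      fix \<phi>
      have "(\<Sum>s\<in>S. a s * (pairing \<psi> (v s k) * (\<Prod>j\<in>D. pairing (\<phi> j) (v s j))))
          = (\<Sum>t\<in>S-{s}. a t * (pairing \<psi> (v t k) * (\<Prod>j\<in>D. pairing (\<phi> j) (v t j))))"
        using s(1) insert.prems(1) \<psi> by (subst sum.remove[of _ s]) auto
      then show "(\<gamma> + pairing \<psi> x) * (\<Prod>j\<in>D. pairing (\<phi> j) u) + ?rest \<phi>
          = (\<Sum>t\<in>S-{s}. (a t * pairing \<psi> (v t k)) * (\<Prod>j\<in>D. pairing (\<phi> j) (v t j)))"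
        using eq[of \<psi> \<phi>] \<psi> by (simp add: algebra_simps)
    qed (use insert.prems in simp)
    moreover have "card S > 0" using s(1) insert.prems(1) by (auto simp: card_gt_0_iff)
    ultimately show ?thesis
      using s(1) insert.hyps insert.prems(1) by simp
  next
    case False
    \<comment> \<open>All factors in slot \<open>k\<close> are multiples of \<open>u\<close>, so
      this functional kills the right-hand side. On the left the summand with \<open>x\<close> in
      slot \<open>k\<close> remains and equals \<open>1\<close> when the other functionals are
      \<open>1\<close> on \<open>u\<close>, a contradiction.\<close>
    obtain \<psi> where \<psi>: "pairing \<psi> u = 0" "pairing \<psi> x = 1"
      using pairing_interpolate[OF u x] by blast
    obtain \<phi> where \<phi>: "pairing \<phi> u = 1"
      using pairing_interpolate[OF u x] by blast
    have "pairing \<psi> (v s k) = 0" if "s \<in> S" for s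
      using False that \<psi>(1) by (metis pairing_smult mult_zero_right)
    then have "(\<Sum>s\<in>S. a s * (pairing \<psi> (v s k) * (\<Prod>j\<in>D. pairing \<phi> (v s j)))) = 0"
      by (intro sum.neutral) auto
    with eq[of \<psi> "\<lambda>_. \<phi>"] \<psi> \<phi> show ?thesis by simp
  qed
qed

lemma contract_pure_tensor:
  fixes v :: "'d::finite \<Rightarrow> 'k::field ^ 'n::finite"
  shows "(\<Sum>I\<in>UNIV. pure_tensor v $ I * (\<Prod>j\<in>UNIV. \<phi> j $ I j)) = (\<Prod>j\<in>UNIV. pairing (\<phi> j) (v j))"
  unfolding pairing_def
  by (subst prod_sum_PiE) (simp_all add: PiE_UNIV pure_tensor_def prod.distrib)

lemma tangent_tensor_rank_ge:
  fixes v :: "'s \<Rightarrow> 'd::finite \<Rightarrow> 'k::field ^ 'n::finite"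
  assumes u: "u \<noteq> 0" and x: "\<And>c. x \<noteq> c *s u" and "finite S"
    and eq: "tangent_tensor u x = (\<Sum>s\<in>S. a s *s pure_tensor (v s))"
  shows "CARD('d) \<le> card S"
proof (rule tangent_form_rank[OF u x finite \<open>finite S\<close>])
  fix \<phi> :: "'d \<Rightarrow> 'k ^ 'n"
  \<comment> \<open>Contraction with the product of the functionals \<open>\<phi> j\<close> turns
    the tensor equation into the multilinear identity of \<open>tangent_form_rank\<close> with
    \<open>\<gamma> = 0\<close>.\<close>
  let ?C = "\<lambda>T. \<Sum>I\<in>UNIV. T $ I * (\<Prod>j\<in>UNIV. \<phi> j $ I j)"
  have "?C (tangent_tensor u x) = (\<Sum>j\<in>UNIV. ?C (pure_tensor ((\<lambda>_. u)(j := x))))"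
    unfolding tangent_tensor_def
    by (simp add: sum_component sum_distrib_right) (rule sum.swap)
  also have "\<dots> = (\<Sum>j\<in>UNIV. pairing (\<phi> j) x * (\<Prod>l\<in>-{j}. pairing (\<phi> l) u))"
    by (simp only: contract_pure_tensor prod_slot[of "\<lambda>y l. pairing (\<phi> l) y"])
  finally have "?C (tangent_tensor u x) = (\<Sum>j\<in>UNIV. pairing (\<phi> j) x * (\<Prod>l\<in>-{j}. pairing (\<phi> l) u))" .
  moreover have "?C (tangent_tensor u x) = (\<Sum>s\<in>S. a s * ?C (pure_tensor (v s)))"
    unfolding eq
    by (simp add: sum_component sum_distrib_right sum_distrib_left mult.assoc) (rule sum.swap)
  ultimately show "0 * (\<Prod>j\<in>UNIV. pairing (\<phi> j) u)
      + (\<Sum>j\<in>UNIV. pairing (\<phi> j) x * (\<Prod>l\<in>UNIV-{j}. pairing (\<phi> l) u))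
      = (\<Sum>s\<in>S. a s * (\<Prod>j\<in>UNIV. pairing (\<phi> j) (v s j)))"
    by (simp add: contract_pure_tensor Compl_eq_Diff_UNIV)
qed

subsection \<open>Equations of the secant variety\<close>

lemma homogeneous_poly_fun_add:
  assumes "homogeneous_poly_fun e F" "homogeneous_poly_fun e G"
  shows "homogeneous_poly_fun e (\<lambda>x. F x + G x)"
proof -
  obtain a b where "F = (\<lambda>x. \<Sum>\<alpha> | (\<Sum>i\<in>UNIV. \<alpha> i) = e. a \<alpha> * (\<Prod>i\<in>UNIV. (x $ i) ^ \<alpha> i))"
    "G = (\<lambda>x. \<Sum>\<alpha> | (\<Sum>i\<in>UNIV. \<alpha> i) = e. b \<alpha> * (\<Prod>i\<in>UNIV. (x $ i) ^ \<alpha> i))"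
    using assms unfolding homogeneous_poly_fun_def by blast
  then show ?thesis
    unfolding homogeneous_poly_fun_def
    by (intro exI[of _ "\<lambda>\<alpha>. a \<alpha> + b \<alpha>"]) (simp add: distrib_right sum.distrib)
qed

lemma homogeneous_poly_fun_uminus:
  assumes "homogeneous_poly_fun e F"
  shows "homogeneous_poly_fun e (\<lambda>x. - F x)"
proof -
  obtain a where "F = (\<lambda>x. \<Sum>\<alpha> | (\<Sum>i\<in>UNIV. \<alpha> i) = e. a \<alpha> * (\<Prod>i\<in>UNIV. (x $ i) ^ \<alpha> i))"
    using assms unfolding homogeneous_poly_fun_def by blast
  then show ?thesis
    unfolding homogeneous_poly_fun_def
    by (intro exI[of _ "\<lambda>\<alpha>. - a \<alpha>"]) (simp add: sum_negf)
qed

lemma homogeneous_poly_fun_diff: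
  assumes "homogeneous_poly_fun e F" "homogeneous_poly_fun e G"
  shows "homogeneous_poly_fun e (\<lambda>x. F x - G x)"
  using homogeneous_poly_fun_add[OF assms(1) homogeneous_poly_fun_uminus[OF assms(2)]] by simp

lemma homogeneous_poly_fun_monomial3:
  "homogeneous_poly_fun 3 (\<lambda>x :: 'k::field ^ 'm::finite. x $ a * x $ b * x $ c)"
proof -
  \<comment> \<open>Adding indicators counts multiplicities, so coinciding coordinates are
    covered.\<close>
  define \<beta> where "\<beta> i = (if i = a then 1 else 0) + (if i = b then 1 else 0) + (if i = c then 1 else 0 :: nat)" for i
  have \<beta>: "(\<Sum>i\<in>UNIV. \<beta> i) = 3"
    by (simp add: \<beta>_def sum.distrib)
  have single: "(\<Prod>i\<in>UNIV. (x $ i) ^ (if i = s then 1 else 0)) = x $ s" for x :: "'k ^ 'm" and s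
  proof -
    have "(\<Prod>i\<in>UNIV. (x $ i) ^ (if i = s then 1 else 0)) = (\<Prod>i\<in>UNIV. if i = s then x $ i else 1)"
      by (rule prod.cong) auto
    then show ?thesis by simp
  qed
  have "x $ a * x $ b * x $ c = (\<Sum>\<alpha> | (\<Sum>i\<in>UNIV. \<alpha> i) = 3. (if \<alpha> = \<beta> then 1 else 0) * (\<Prod>i\<in>UNIV. (x $ i) ^ \<alpha> i))"
    for x :: "'k ^ 'm"
  proof -
    have "(\<Sum>\<alpha> | (\<Sum>i\<in>UNIV. \<alpha> i) = 3. (if \<alpha> = \<beta> then 1 else 0) * (\<Prod>i\<in>UNIV. (x $ i) ^ \<alpha> i))
        = (\<Sum>\<alpha> | (\<Sum>i\<in>UNIV. \<alpha> i) = 3. if \<alpha> = \<beta> then \<Prod>i\<in>UNIV. (x $ i) ^ \<alpha> i else 0)"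
      by (rule sum.cong) auto
    also have "\<dots> = (\<Prod>i\<in>UNIV. (x $ i) ^ \<beta> i)"
      using finite_exponents \<beta> by (subst sum.delta) auto
    also have "\<dots> = x $ a * x $ b * x $ c"
      unfolding \<beta>_def power_add prod.distrib single ..
    finally show ?thesis by simp
  qed
  then show ?thesis
    unfolding homogeneous_poly_fun_def
    by (intro exI[of _ "\<lambda>\<alpha>. if \<alpha> = \<beta> then 1 else 0"] ext)
qed

lemma homogeneous_poly_fun_minor3:
  "homogeneous_poly_fun 3 (\<lambda>x :: 'k::field ^ 'm::finite. minor3 (\<lambda>i J. x $ g i J) i j k a b c)"
  unfolding minor3_def
  by (intro homogeneous_poly_fun_add homogeneous_poly_fun_diff homogeneous_poly_fun_monomial3)

lemma minor3_cong:
  assumes "\<And>i' x'. \<lbrakk>i' \<in> {i, j, k}; x' \<in> {x, y, z}\<rbrakk> \<Longrightarrow> M i' x' = N i' x'"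
  shows "minor3 M i j k x y z = minor3 N i j k x y z"
  unfolding minor3_def using assms by simp

text \<open>One representative among the indices with \<open>q\<close> in \<open>k\<close> slots and
  \<open>p\<close> elsewhere. On a symmetric tensor its coordinate is, up to a binomial factor, the
  coefficient of the binary form in the coordinates \<open>p\<close> and \<open>q\<close>. It is
  meaningful for \<open>k \<le> CARD('d)\<close>.\<close>

definition mixed_index :: "'n \<Rightarrow> 'n \<Rightarrow> nat \<Rightarrow> 'd::finite \<Rightarrow> 'n"
  where "mixed_index p q k = (\<lambda>l. if l \<in> (SOME A. card A = k) then q else p)"

lemma card_some_subset:
  assumes "k \<le> CARD('d::finite)"
  shows "card (SOME A :: 'd set. card A = k) = k"
proof -
  obtain A :: "'d set" where "card A = k"
    using obtain_subset_with_card_n[OF assms] by blast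
  then show ?thesis by (rule someI)
qed

lemma symmetric_tensor_mixed_index:
  fixes T :: "('k::field, 'n::finite, 'd::finite) tensor"
  assumes "T \<in> symmetric_tensors"
  shows "T $ (\<lambda>l. if l \<in> A then q else p) = T $ mixed_index p q (card A)"
  unfolding mixed_index_def
  by (rule symmetric_tensor_two_valued[OF assms]) (simp add: card_some_subset card_mono)

lemma pure_tensor_mixed_index:
  assumes "k \<le> CARD('d::finite)"
  shows "pure_tensor (\<lambda>_ :: 'd. u) $ mixed_index p q k = u $ q ^ k * u $ p ^ (CARD('d) - k)"
proof -
  let ?A = "SOME A :: 'd set. card A = k"
  have "pure_tensor (\<lambda>_ :: 'd. u) $ mixed_index p q k = (\<Prod>l\<in>UNIV. if l \<in> ?A then u $ q else u $ p)"
    unfolding pure_tensor_const_nth mixed_index_def by (rule prod.cong) auto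
  also have "\<dots> = u $ q ^ card ?A * u $ p ^ card (-?A)"
    by (simp add: prod.If_cases)
  finally show ?thesis
    by (simp add: card_some_subset[OF assms] Compl_eq_Diff_UNIV card_Diff_subset)
qed

text \<open>
  The \<open>3 \<times> 3\<close> minors of the \<open>(1, d - 1)\<close> flattening, and those of the Hankel matrices
  of the binary forms obtained by restricting to two coordinates.
\<close>
definition secant_equations :: "(('k::field, 'n::finite, 'd::finite) tensor \<Rightarrow> 'k) set"
  where "secant_equations =
    {\<lambda>T. minor3 (\<lambda>i J. T $ (J(undefined := i))) i j k x y z | i j k x y z. True} \<union>
    {\<lambda>T. minor3 (\<lambda>i m. T $ mixed_index p q (m + i)) i j k x y z | p q i j k x y z.
       i < 3 \<and> j < 3 \<and> k < 3 \<and> x + 2 \<le> CARD('d) \<and> y + 2 \<le> CARD('d) \<and> z + 2 \<le> CARD('d)}"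

lemma homogeneous_secant_equations:
  "F \<in> secant_equations \<Longrightarrow> homogeneous_poly_fun 3 F"
  unfolding secant_equations_def by (auto intro: homogeneous_poly_fun_minor3)

text \<open>Each power contributes a matrix of rank at most one to either kind of flattening. In the
  first kind a column \<open>J\<close> is a full index whose entry in the distinguished slot is
  overwritten, which merely repeats columns.\<close>

lemma secant_equations_vanish:
  fixes u w :: "'k::field ^ 'n::finite" and a b :: 'k
  defines "T \<equiv> (a *s pure_tensor (\<lambda>_. u) + b *s pure_tensor (\<lambda>_. w) :: ('k, 'n, 'd::finite) tensor)"
  assumes "F \<in> secant_equations"
  shows "F T = 0"
proof -
  from assms(2) consider
    (flat) i j k x y z where "F = (\<lambda>T. minor3 (\<lambda>i J. T $ (J(undefined := i))) i j k x y z)"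
  | (hankel) p q i j k x y z where "F = (\<lambda>T. minor3 (\<lambda>i m. T $ mixed_index p q (m + i)) i j k x y z)"
      "i < 3" "j < 3" "k < 3" "x + 2 \<le> CARD('d)" "y + 2 \<le> CARD('d)" "z + 2 \<le> CARD('d)"
    unfolding secant_equations_def by blast
  then show ?thesis
  proof cases
    case flat
    have "pure_tensor (\<lambda>_. v) $ (J(j := i)) = v $ i * (\<Prod>l\<in>-{j}. v $ J l)"
      for v :: "'k ^ 'n" and J :: "'d \<Rightarrow> 'n" and i j
    proof -
      have "(\<Prod>l\<in>UNIV. v $ (J(j := i)) l) = v $ i * (\<Prod>l\<in>UNIV-{j}. v $ (J(j := i)) l)"
        by (subst prod.remove[of _ j]) auto
      also have "(\<Prod>l\<in>UNIV-{j}. v $ (J(j := i)) l) = (\<Prod>l\<in>-{j}. v $ J l)"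
        by (rule prod.cong) auto
      finally show ?thesis by (simp only: pure_tensor_const_nth)
    qed
    then have "F T = minor3 (\<lambda>i J. (a * u $ i) * (\<Prod>l\<in>-{undefined}. u $ J l)
        + (b * w $ i) * (\<Prod>l\<in>-{undefined}. w $ J l)) i j k x y z"
      unfolding flat T_def by (simp add: mult.assoc)
    then show ?thesis by (simp only: minor3_rank2)
  next
    case hankel
    \<comment> \<open>The bounds on \<open>i\<close> and \<open>m\<close> make every truncated
      subtraction exact, so the Hankel entry separates into a factor in \<open>i\<close> and a
      factor in \<open>m\<close>.\<close>
    have split: "pure_tensor (\<lambda>_ :: 'd. v) $ mixed_index p q (m + i)
        = (v $ q ^ i * v $ p ^ (2 - i)) * (v $ q ^ m * v $ p ^ (CARD('d) - 2 - m))"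
      if "i < 3" "m + 2 \<le> CARD('d)" for v :: "'k ^ 'n" and i m
    proof -
      have "CARD('d) - (m + i) = (2 - i) + (CARD('d) - 2 - m)" "m + i \<le> CARD('d)"
        using that by linarith+
      then show ?thesis
        by (simp only: pure_tensor_mixed_index power_add) (simp add: mult_ac)
    qed
    have "F T = minor3 (\<lambda>i m. (a * (u $ q ^ i * u $ p ^ (2 - i))) * (u $ q ^ m * u $ p ^ (CARD('d) - 2 - m))
        + (b * (w $ q ^ i * w $ p ^ (2 - i))) * (w $ q ^ m * w $ p ^ (CARD('d) - 2 - m))) i j k x y z"
      unfolding hankel(1)
    proof (rule minor3_cong)
      fix i' m assume "i' \<in> {i, j, k}" "m \<in> {x, y, z}"
      then have "i' < 3" "m + 2 \<le> CARD('d)" using hankel by auto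
      then show "T $ mixed_index p q (m + i')
          = (a * (u $ q ^ i' * u $ p ^ (2 - i'))) * (u $ q ^ m * u $ p ^ (CARD('d) - 2 - m))
          + (b * (w $ q ^ i' * w $ p ^ (2 - i'))) * (w $ q ^ m * w $ p ^ (CARD('d) - 2 - m))"
        unfolding T_def by (simp only: vector_add_component vector_smult_component split mult.assoc)
    qed
    then show ?thesis by (simp only: minor3_rank2)
  qed
qed

lemma two_powers_symmetric:
  fixes u w :: "'k::field ^ 'n::finite"
  shows "(a *s pure_tensor (\<lambda>_. u) + b *s pure_tensor (\<lambda>_. w) :: ('k, 'n, 'd::finite) tensor) \<in> symmetric_tensors"
proof -
  have "(\<Prod>j\<in>UNIV. v $ I (\<pi> j)) = (\<Prod>j\<in>UNIV. v $ I j)"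
    if "\<pi> permutes UNIV" for v :: "'k ^ 'n" and I :: "'d \<Rightarrow> 'n" and \<pi>
    using prod.permute[OF that, of "\<lambda>j. v $ I j"] by (simp add: o_def)
  note perm = this
  show ?thesis
    unfolding symmetric_tensors_def
  proof (intro CollectI allI impI)
    fix \<pi> and I :: "'d \<Rightarrow> 'n" assume "\<pi> permutes (UNIV :: 'd set)"
    then show "(a *s pure_tensor (\<lambda>_. u) + b *s pure_tensor (\<lambda>_. w)) $ (I \<circ> \<pi>)
        = (a *s pure_tensor (\<lambda>_. u) + b *s pure_tensor (\<lambda>_. w)) $ I"
      by (simp only: vector_add_component vector_smult_component pure_tensor_const_nth o_apply
          perm[of \<pi> u I] perm[of \<pi> w I])
  qed
qed

section \<open>Secant lines and their Zariski closure\<close>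

lemma proj_class_memD: "x \<in> proj_class y \<Longrightarrow> \<exists>c. x = c *s y"
  by (auto simp: proj_class_def vec.span_singleton)

lemma proj_class_self: "x \<in> proj_class x"
  by (simp add: proj_class_def vec.span_base)

lemma span_two_classes:
  assumes "y \<in> vec.span (proj_class s \<union> proj_class t)"
  shows "\<exists>a b. y = a *s s + b *s t"
proof -
  have "proj_class s \<union> proj_class t \<subseteq> vec.span {s, t}"
    unfolding proj_class_def by (intro Un_least vec.span_mono) auto
  then have "y \<in> vec.span {s, t}"
    using assms vec.span_minimal vec.subspace_span by blast
  then obtain a where "y - a *s s \<in> vec.span {t}"
    by (auto simp: vec.span_insert)
  then obtain b where "y - a *s s = b *s t"
    by (auto simp: vec.span_singleton)
  then have "y = a *s s + b *s t" by (simp add: algebra_simps)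
  then show ?thesis by blast
qed

text \<open>The common zero locus of the equations is closed and contains every secant line, hence
  also the closure of their union.\<close>

lemma sigma2_veronese_equations:
  fixes P :: "('k::field, 'n::finite, 'd::finite) tensor set"
  assumes "P \<in> sigma2_veronese"
  shows "\<exists>T. P = proj_class T \<and> T \<noteq> 0 \<and> T \<in> symmetric_tensors \<and> (\<forall>F\<in>secant_equations. F T = 0)"
proof -
  define Z where "Z = proj_zero_locus symmetric_tensors
    (secant_equations :: (('k, 'n, 'd) tensor \<Rightarrow> 'k) set)"
  have "zariski_closed_in symmetric_tensors Z"
    unfolding zariski_closed_in_def Z_def using homogeneous_secant_equations by blast
  moreover have "proj_span {A, B} \<subseteq> Z" if AB: "A \<in> veronese" "B \<in> veronese" for A B
  proof
    fix Q assume "Q \<in> proj_span {A, B}"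
    then obtain y where y: "Q = proj_class y" "y \<in> vec.span (A \<union> B)" "y \<noteq> 0"
      by (auto simp: proj_span_def projectivization_def)
    obtain u w where "A = proj_class (pure_tensor (\<lambda>_. u))" "B = proj_class (pure_tensor (\<lambda>_. w))"
      using AB by (auto simp: veronese_def)
    with y(2) obtain a b where ab: "y = a *s pure_tensor (\<lambda>_. u) + b *s pure_tensor (\<lambda>_. w)"
      using span_two_classes by blast
    have "F x = 0" if F: "F \<in> secant_equations" and "x \<in> Q" for F x
    proof -
      obtain c where "x = c *s y" using \<open>x \<in> Q\<close> y(1) proj_class_memD by blast
      then have "x = (c * a) *s pure_tensor (\<lambda>_. u) + (c * b) *s pure_tensor (\<lambda>_. w)"
        by (simp add: ab)
      then show ?thesis using secant_equations_vanish[OF F] by simp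
    qed
    moreover have "Q \<in> projectivization symmetric_tensors"
      using y(1,3) two_powers_symmetric ab unfolding projectivization_def by blast
    ultimately show "Q \<in> Z" by (auto simp: Z_def proj_zero_locus_def)
  qed
  ultimately have "P \<in> Z"
    using assms unfolding sigma2_veronese_def zariski_closure_in_def by blast
  then obtain T where T: "P = proj_class T" "T \<in> symmetric_tensors" "T \<noteq> 0"
    "\<forall>F\<in>secant_equations. \<forall>x\<in>P. F x = 0"
    by (auto simp: Z_def proj_zero_locus_def projectivization_def)
  have "F T = 0" if "F \<in> secant_equations" for F
    using T(1,4) that proj_class_self by blast
  with T(1-3) show ?thesis by blast
qed

text \<open>The flattening supplies two slices \<open>p\<close> and \<open>q\<close> spanning all
  others, so \<open>T\<close> is a binary form whose coefficients \<open>c\<close> are its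
  coordinates with entries \<open>p\<close> and \<open>q\<close>. The Hankel minors for this very
  pair supply the recurrence.\<close>

lemma secant_equations_classification:
  fixes T :: "('k::{alg_closed_field, field_char_0}, 'n::finite, 'd::finite) tensor"
  assumes sym: "T \<in> symmetric_tensors"
    and eqs: "\<And>F. F \<in> secant_equations \<Longrightarrow> F T = 0"
  shows "two_powers_or_tangent T"
proof -
  have "minor3 (\<lambda>i J. T $ (J(undefined := i))) i j k x y z = 0" for i j k x y z
    by (rule eqs[of "\<lambda>T. minor3 (\<lambda>i J. T $ (J(undefined := i))) i j k x y z"])
      (unfold secant_equations_def, blast)
  then have "\<exists>p\<in>UNIV. \<exists>q\<in>UNIV. \<exists>e f. \<forall>i\<in>UNIV. \<forall>J\<in>UNIV.
      T $ (J(undefined := i)) = T $ (J(undefined := p)) * e i + T $ (J(undefined := q)) * f i"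
    by (intro rank2_rows[of UNIV UNIV "\<lambda>i J. T $ (J(undefined := i))"]) auto
  then obtain p q e f where rel:
    "\<And>J i. T $ (J(undefined := i)) = T $ (J(undefined := p)) * e i + T $ (J(undefined := q)) * f i"
    by blast
  have fibre: "T $ (J(undefined := i)) = T $ (J(undefined := p)) * (\<chi> i. e i) $ i
      + T $ (J(undefined := q)) * (\<chi> i. f i) $ i" for J i
    unfolding vec_lambda_beta by (rule rel)
  define c where "c k = T $ mixed_index p q k" for k
  have expand: "T $ I = (\<Sum>A\<in>UNIV. c (card A)
      * ((\<Prod>j\<in>A. (\<chi> i. f i) $ I j) * (\<Prod>j\<in>-A. (\<chi> i. e i) $ I j)))" for I
    using symmetric_tensor_expand[OF sym fibre, of I]
    unfolding symmetric_tensor_mixed_index[OF sym] c_def .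
  have "minor3 (\<lambda>i m. c (m + i)) i j k x y z = 0"
    if "i < 3" "j < 3" "k < 3" "x \<in> {m. m + 2 \<le> CARD('d)}" "y \<in> {m. m + 2 \<le> CARD('d)}"
      "z \<in> {m. m + 2 \<le> CARD('d)}" for i j k x y z
    unfolding c_def
    by (rule eqs[of "\<lambda>T. minor3 (\<lambda>i m. T $ mixed_index p q (m + i)) i j k x y z"])
      (use that in \<open>unfold secant_equations_def, blast\<close>)
  \<comment> \<open>For \<open>CARD('d) = 1\<close> the Hankel matrix has no columns and the
    recurrence is vacuous.\<close>
  then have "\<exists>q0 q1 q2. (q0 \<noteq> 0 \<or> q1 \<noteq> 0 \<or> q2 \<noteq> 0)
      \<and> (\<forall>x\<in>{m. m + 2 \<le> CARD('d)}. q0 * c (x + 0) + q1 * c (x + 1) + q2 * c (x + 2) = 0)"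
    by (rule three_rows_dependent)
  then obtain q0 q1 q2 where nz: "q0 \<noteq> 0 \<or> q1 \<noteq> 0 \<or> q2 \<noteq> 0"
    and rel: "\<forall>x\<in>{m. m + 2 \<le> CARD('d)}. q0 * c (x + 0) + q1 * c (x + 1) + q2 * c (x + 2) = 0"
    by blast
  show ?thesis
    by (rule binary_form_cases[OF expand nz]) (use rel in auto)
qed

subsection \<open>Comparison of the ranks\<close>

text \<open>Zero vectors give zero tensors and no point of the Veronese variety, so they are dropped
  from \<open>S\<close>. Distinct summands may define the same point, which only lowers the
  cardinality.\<close>

lemma rank_wrt_veronese_le:
  fixes v :: "'s \<Rightarrow> 'k::field ^ 'n::finite" and T :: "('k, 'n, 'd::finite) tensor"
  assumes "finite B" "T \<noteq> 0" and T: "T = (\<Sum>s\<in>B. a s *s pure_tensor (\<lambda>_. v s))"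
  shows "rank_wrt veronese (proj_class T) \<le> enat (card B)"
proof -
  define S where "S = (\<lambda>s. proj_class (pure_tensor (\<lambda>_ :: 'd. v s))) ` {s \<in> B. v s \<noteq> 0}"
  have "a s *s pure_tensor (\<lambda>_. v s) \<in> vec.span (\<Union>S)" if "s \<in> B" for s
  proof (cases "v s = 0")
    case True
    then have "pure_tensor (\<lambda>_. v s) = (0 :: ('k, 'n, 'd) tensor)"
      by (simp add: vec_eq_iff pure_tensor_const_nth zero_power card_gt_0_iff)
    then show ?thesis by (simp add: vec.span_zero)
  next
    case False
    then have "pure_tensor (\<lambda>_ :: 'd. v s) \<in> \<Union>S"
      using that proj_class_self unfolding S_def by blast
    then show ?thesis by (intro vec.span_scale vec.span_base)
  qed
  then have "T \<in> vec.span (\<Union>S)"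
    unfolding T by (rule vec.span_sum)
  with \<open>T \<noteq> 0\<close> have "proj_class T \<in> proj_span S"
    unfolding proj_span_def projectivization_def by blast
  moreover have "S \<subseteq> veronese" "finite S"
    using assms(1) by (auto simp: S_def veronese_def)
  ultimately have "rank_wrt veronese (proj_class T) \<le> enat (card S)"
    unfolding rank_wrt_def by (intro INF_lower) simp
  also have "card S \<le> card {s \<in> B. v s \<noteq> 0}"
    unfolding S_def using assms(1) by (intro card_image_le) simp
  then have "enat (card S) \<le> enat (card B)"
    using card_mono[OF assms(1), of "{s \<in> B. v s \<noteq> 0}"] by simp
  finally show ?thesis .
qed

text \<open>Every point of \<open>S\<close> is the line through one chosen pure tensor, so these
  representatives span \<open>\<Union>S\<close>. The tensors themselves serve as summation
  indices.\<close>

lemma segre_span_decompose: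
  fixes T :: "('k::field, 'n::finite, 'd::finite) tensor"
  assumes S: "S \<subseteq> segre" "finite S" and T: "proj_class T \<in> proj_span S"
  shows "\<exists>B a (v :: ('k, 'n, 'd) tensor \<Rightarrow> 'd \<Rightarrow> 'k ^ 'n).
    finite B \<and> card B \<le> card S \<and> T = (\<Sum>s\<in>B. a s *s pure_tensor (v s))"
proof -
  obtain y where y: "proj_class T = proj_class y" "y \<in> vec.span (\<Union>S)"
    using T by (auto simp: proj_span_def projectivization_def)
  obtain c where "T = c *s y"
    using y(1) proj_class_self proj_class_memD by blast
  then have T': "T \<in> vec.span (\<Union>S)"
    using y(2) by (simp add: vec.span_scale)
  have "\<forall>L\<in>S. \<exists>v. L = proj_class (pure_tensor v)"
    using S(1) by (auto simp: segre_def)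
  then obtain g where g: "\<And>L. L \<in> S \<Longrightarrow> L = proj_class (pure_tensor (g L))"
    by metis
  define B where "B = (\<lambda>L. pure_tensor (g L)) ` S"
  have "\<Union>S \<subseteq> vec.span B"
  proof
    fix x assume "x \<in> \<Union>S"
    then obtain L where L: "L \<in> S" "x \<in> proj_class (pure_tensor (g L))" using g by blast
    then obtain c where "x = c *s pure_tensor (g L)" using proj_class_memD by blast
    moreover have "pure_tensor (g L) \<in> B" using L(1) by (simp add: B_def)
    ultimately show "x \<in> vec.span B" by (simp add: vec.span_scale vec.span_base)
  qed
  then have "T \<in> vec.span B"
    using T' vec.span_minimal vec.subspace_span by blast
  moreover have B: "finite B" "card B \<le> card S"
    using S(2) by (simp_all add: B_def card_image_le)
  ultimately obtain a where a: "T = (\<Sum>s\<in>B. a s *s s)"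
    by (auto simp: vec.span_finite)
  have "\<forall>s\<in>B. \<exists>v. s = pure_tensor v" by (auto simp: B_def)
  then obtain v where "\<And>s. s \<in> B \<Longrightarrow> s = pure_tensor (v s)" by metis
  then have "(\<Sum>s\<in>B. a s *s pure_tensor (v s)) = (\<Sum>s\<in>B. a s *s s)"
    by (intro sum.cong) simp_all
  with a B show ?thesis
    by (intro exI[of _ B] exI[of _ a] exI[of _ v]) simp
qed

lemma rank_wrt_veronese_le_1:
  fixes T :: "('k::field, 'n::finite, 'd::finite) tensor"
  assumes "T \<noteq> 0" "T = a *s pure_tensor (\<lambda>_. u)"
  shows "rank_wrt veronese (proj_class T) \<le> 1"
proof -
  have "T = (\<Sum>s\<in>{()}. a *s pure_tensor (\<lambda>_. u))" using assms(2) by simp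
  from rank_wrt_veronese_le[OF _ assms(1) this] show ?thesis by (simp add: one_enat_def)
qed

text \<open>Any decomposition into pure tensors is compared with an explicit one into powers: at
  most two powers on a secant, where a single pure summand is handled by
  \<open>rank1_symmetric_tensor\<close>, and \<open>CARD('d)\<close> powers for a genuine tangent
  tensor, where \<open>tangent_tensor_rank_ge\<close> applies. Degenerate tangents are multiples of
  one power.\<close>

lemma veronese_rank_le_card:
  fixes T :: "('k::{alg_closed_field, field_char_0}, 'n::finite, 'd::finite) tensor"
  assumes T: "T \<noteq> 0" "T \<in> symmetric_tensors" "two_powers_or_tangent T"
    and "finite B" and sum: "T = (\<Sum>s\<in>B. a s *s pure_tensor (v s))"
  shows "rank_wrt veronese (proj_class T) \<le> enat (card B)"
proof -
  have "card B \<noteq> 0" using T(1) sum assms(4) by auto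
  then have pos: "1 \<le> enat (card B)" by (simp add: one_enat_def)
  have one: "rank_wrt veronese (proj_class T) \<le> enat (card B)" if "T = c *s pure_tensor (\<lambda>_. u)" for c u
    using rank_wrt_veronese_le_1[OF T(1) that] pos by (rule order_trans)
  from T(3) consider
    (secant) b c u w where "T = b *s pure_tensor (\<lambda>_. u) + c *s pure_tensor (\<lambda>_. w)"
  | (tangent) u x where "T = tangent_tensor u x"
    unfolding two_powers_or_tangent_def by blast
  then show ?thesis
  proof cases
    case secant
    show ?thesis
    proof (cases "card B \<ge> 2")
      case True
      have "T = (\<Sum>i\<in>UNIV. (if i then b else c) *s pure_tensor (\<lambda>_. if i then u else w))"
        by (simp add: secant UNIV_bool)
      from rank_wrt_veronese_le[OF _ T(1) this]
      have "rank_wrt veronese (proj_class T) \<le> enat 2" by simp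
      also have "\<dots> \<le> enat (card B)" using True by simp
      finally show ?thesis .
    next
      case False
      with \<open>card B \<noteq> 0\<close> have "card B = 1" by linarith
      then obtain s where s: "T = a s *s pure_tensor (v s)"
        using sum by (auto simp: card_1_singleton_iff)
      with T(1) have as: "a s \<noteq> 0" by auto
      have "pure_tensor (v s) \<in> symmetric_tensors"
        using T(2) as unfolding s by (auto simp: symmetric_tensors_def)
      then obtain c u where "pure_tensor (v s) = c *s pure_tensor (\<lambda>_. u)"
        by (rule rank1_symmetric_tensor)
      then have "T = (a s * c) *s pure_tensor (\<lambda>_. u)" using s by simp
      then show ?thesis by (rule one)
    qed
  next
    case tangent
    have "CARD('d) > 0" by simp
    then consider "CARD('d) = 1" | "CARD('d) \<ge> 2" by linarith
    then show ?thesis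
    proof cases
      case 1
      \<comment> \<open>With a single factor every tensor is a vector and thus its own first
        power.\<close>
      then obtain j :: 'd where j: "(UNIV :: 'd set) = {j}" by (auto simp: card_1_singleton_iff)
      have "T $ I = (1 *s pure_tensor (\<lambda>_. \<chi> i. T $ (\<lambda>_. i))) $ I" for I
      proof -
        have "(\<lambda>_. I j) = I" using j by (auto simp: fun_eq_iff)
        then show ?thesis by (simp add: pure_tensor_const_nth j)
      qed
      then show ?thesis by (intro one vec_eq_iff[THEN iffD2] allI)
    next
      case 2
      show ?thesis
      proof (cases "u = 0 \<or> (\<exists>c. x = c *s u)")
        case True
        then show ?thesis
        proof
          assume u: "u = 0"
          \<comment> \<open>With at least two slots, every summand of the tangent tensor keeps a
            factor \<open>u = 0\<close>.\<close>
          have "-{j} \<noteq> {}" for j :: 'd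
          proof
            assume "-{j} = {}"
            then have "(UNIV :: 'd set) = {j}" by auto
            then have "CARD('d) = 1" by (metis card_1_singleton_iff One_nat_def)
            with 2 show False by simp
          qed
          then have "T = 0"
            by (simp add: tangent u vec_eq_iff tangent_tensor_nth zero_power card_gt_0_iff)
          with T(1) show ?thesis by simp
        next
          assume "\<exists>c. x = c *s u"
          then obtain c where c: "x = c *s u" by blast
          have "T = 0 *s tangent_tensor u x + (c * of_nat CARD('d)) *s pure_tensor (\<lambda>_. u)"
            using tangent_tensor_parallel[of u 0 x c] by (simp add: tangent c)
          then have "T = (c * of_nat CARD('d)) *s pure_tensor (\<lambda>_. u)" by simp
          then show ?thesis by (rule one)
        qed
      next
        case False
        then have ux: "u \<noteq> 0" "\<And>c. x \<noteq> c *s u" by auto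
        have "finite {z :: 'k. z ^ CARD('d) = 1}"
          using card_unity_roots[of "CARD('d)", where 'k='k] by (metis card.infinite zero_less_card_finite less_irrefl)
        then have "rank_wrt veronese (proj_class T) \<le> enat (card {z :: 'k. z ^ CARD('d) = 1})"
          by (rule rank_wrt_veronese_le[OF _ T(1) trans[OF tangent tangent_tensor_eq_sum_powers[OF refl 2]]])
        also have "\<dots> = enat CARD('d)" by (simp add: card_unity_roots)
        also have "\<dots> \<le> enat (card B)"
          using tangent_tensor_rank_ge[OF ux assms(4)] sum tangent by simp
        finally show ?thesis .
      qed
    qed
  qed
qed

theorem corollary2:
  fixes n d :: nat
    and P :: "('k::{alg_closed_field, field_char_0}, 'n::finite, 'd::finite) tensor set"
  assumes "n \<ge> 1" and "d \<ge> 1"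
    and "CARD('n) = n + 1" and "CARD('d) = d"
    and "P \<in> sigma2_veronese"
  shows "rank_wrt veronese P = rank_wrt segre P"
proof (rule antisym)
  obtain T where T: "P = proj_class T" "T \<noteq> 0" "T \<in> symmetric_tensors"
    "\<forall>F\<in>secant_equations. F T = 0"
    using sigma2_veronese_equations[OF assms(5)] by blast
  have cases: "two_powers_or_tangent T"
    using T(3,4) by (intro secant_equations_classification) auto
  show "rank_wrt veronese P \<le> rank_wrt segre P"
    unfolding rank_wrt_def[of segre]
  \<comment> \<open>Bounding the symmetric rank by \<open>card S\<close> for every admissible
    \<open>S\<close> also covers an infimum over the empty set.\<close>
  proof (rule INF_greatest)
    fix S assume "S \<in> {S. S \<subseteq> segre \<and> finite S \<and> P \<in> proj_span S}"
    then have "S \<subseteq> segre" "finite S" "proj_class T \<in> proj_span S" using T(1) by auto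
    from segre_span_decompose[OF this]
    obtain B a and v :: "('k, 'n, 'd) tensor \<Rightarrow> 'd \<Rightarrow> 'k ^ 'n"
      where B: "finite B" "card B \<le> card S" "T = (\<Sum>s\<in>B. a s *s pure_tensor (v s))"
      by blast
    have "rank_wrt veronese (proj_class T) \<le> enat (card B)"
      by (rule veronese_rank_le_card[OF T(2,3) cases B(1,3)])
    also have "\<dots> \<le> enat (card S)" using B(2) by simp
    finally show "rank_wrt veronese P \<le> enat (card S)" using T(1) by simp
  qed
  have "veronese \<subseteq> (segre :: ('k, 'n, 'd) tensor set set)"
    by (auto simp: veronese_def segre_def)
  then show "rank_wrt segre P \<le> rank_wrt veronese P"
    unfolding rank_wrt_def by (intro INF_superset_mono) auto
qed

end
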